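(* Let $\mathcal{A}$ be a unital $C^*$-algebra and let $\mathcal{F}\subseteq\mathcal{A}\cong B(\mathcal{A})$ be an ideal of finite type elements. Then the sets $$\mathcal{M}\mathcal{K}\Phi_{+}(\mathcal{A})\setminus\mathcal{M}\mathcal{K}{\Phi_{+}^{-}}'(\mathcal{A}),\qquad \mathcal{M}\mathcal{K}\Phi_{-}(\mathcal{A})\setminus\mathcal{M}\mathcal{K}{\Phi_{-}^{+}}'(\mathcal{A}),\qquad \mathcal{M}\mathcal{K}\Phi(\mathcal{A})\setminus\mathcal{M}\mathcal{K}\Phi_{0}(\mathcal{A})$$ are open (in the norm topology of $B(\mathcal{A})$).
   Context: $\mathcal{A}$ is regarded as a right Hilbert module over itself and $B(\mathcal{A})$ is the $C^*$-algebra of all bounded $\mathcal{A}$-linear operators on $\mathcal{A}$ (all are adjointable). The map $a\mapsto L_a$ (left multiplication by $a$) is an isometric $*$-isomorphism $\mathcal{A}\to B(\mathcal{A})$, and $\mathcal{A}$ is identified with $B(\mathcal{A})$ through it; accordingly $\mathcal{F}$ is identified with its image in $B(\mathcal{A})$. Ideal of finite type elements: a subalgebra $\mathcal{F}\subseteq\mathcal{A}$ such that (i) $\mathcal{F}$ is a selfadjoint (two-sided) ideal in $\mathcal{A}$; (ii) there is an approximate unit $\{P_\alpha\}$ for $\mathcal{F}$, contained in $\mathcal{F}$, consisting of (orthogonal) projections; (iii) if $p,q\in\mathcal{F}$ are projections, then there exists $v\in\mathcal{A}$ such that $vv^*=q$ and $v^*v\perp p$, i.e. $v^*v+p$ is a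 projection as well. For closed submodules $M_1,M_2$ of a Hilbert module $M$, $M=M_1\tilde\oplus M_2$ means $M_1\cap M_2=\{0\}$ and $M_1+M_2=M$ (not necessarily orthogonal). A closed submodule is complementable if it is a summand in such a decomposition. Every closed complementable submodule $M$ of $\mathcal{A}$ is orthogonally complementable; $P_M$ denotes the orthogonal projection onto $M$. Isomorphism (symbol $\cong$) means a bounded $\mathcal{A}$-linear bijection with bounded inverse, and $N\preceq N'$ means that $N$ is isomorphic to a closed submodule of $N'$. For $F\in B(\mathcal{A})$ consider decompositions $\mathcal{A}=M_1\tilde\oplus N_1\stackrel{F}{\longrightarrow}M_2\tilde\oplus N_2=\mathcal{A}$ (closed submodules) with respect to which $F$ has the matrix $\begin{pmatrix}F_1&0\\0&F_4\end{pmatrix}$ with $F_1:M_1\to M_2$ an isomorphism. Such a decomposition is called an $\mathcal{M}\mathcal{K}\Phi_+$-decomposition if $P_{N_1}\in\mathcal{F}$, an $\mathcal{M}\mathcal{K}\Phi_-$-decomposition if $P_{N_2}\in\mathcal{F}$, and an $\mathcal{M}\mathcal{K}\Phi$-decomposition if $P_{N_1},P_{N_2}\in\mathcal{F}$. The sets $\mathcal{M}\mathcal{K}\Phi_+(\mathcal{A})$, $\mathcal{M}\mathcal{K}\Phi_-(\mathcal{A})$, $\mathcal{M}\mathcal{K}\Phi(\mathcal{A})$ consist of those $F\in B(\mathcal{A})$ which admit, respectively, an $\mathcal{M}\mathcal{K}\Phi_+$-, $\mathcal{M}\mathcal{K}\Phi_-$-, $\mathcal{M}\mathcal{K}\Phi$-decomposition.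 $\mathcal{M}\mathcal{K}{\Phi_{+}^{-}}'(\mathcal{A})$: those $F$ admitting an $\mathcal{M}\mathcal{K}\Phi_+$-decomposition with $N_1\preceq N_2$. $\mathcal{M}\mathcal{K}{\Phi_{-}^{+}}'(\mathcal{A})$: those $F$ admitting an $\mathcal{M}\mathcal{K}\Phi_-$-decomposition with $N_2\preceq N_1$. $\mathcal{M}\mathcal{K}\Phi_0(\mathcal{A})$: those $F$ admitting an $\mathcal{M}\mathcal{K}\Phi$-decomposition with $N_1\cong N_2$. *)

theory Defs
  imports "HOL-Analysis.Analysis"
begin

section \<open>Unital C*-algebras\<close>

class unital_cstar_algebra = real_normed_algebra_1 + banach +
  fixes scaleC :: "complex \<Rightarrow> 'a \<Rightarrow> 'a" (infixr \<open>*\<^sub>C\<close> 75)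
    and star :: "'a \<Rightarrow> 'a"
  assumes scaleC_add_right: "c *\<^sub>C (x + y) = c *\<^sub>C x + c *\<^sub>C y"
    and scaleC_add_left: "(c + d) *\<^sub>C x = c *\<^sub>C x + d *\<^sub>C x"
    and scaleC_scaleC: "c *\<^sub>C d *\<^sub>C x = (c * d) *\<^sub>C x"
    and scaleC_of_real: "complex_of_real r *\<^sub>C x = r *\<^sub>R x"
    and mult_scaleC_left: "(c *\<^sub>C x) * y = c *\<^sub>C (x * y)"
    and mult_scaleC_right: "x * (c *\<^sub>C y) = c *\<^sub>C (x * y)"
    and norm_scaleC: "norm (c *\<^sub>C x) = cmod c * norm x"
    and star_add: "star (x + y) = star x + star y"
    and star_scaleC: "star (c *\<^sub>C x) = cnj c *\<^sub>C star x"
    and star_mult: "star (x * y) = star y * star x"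
    and star_star: "star (star x) = x"
    and cstar_identity: "norm (star x * x) = (norm x)\<^sup>2"

definition is_projection :: "'a::unital_cstar_algebra \<Rightarrow> bool" where
  "is_projection p \<longleftrightarrow> star p = p \<and> p * p = p"


section \<open>Ideals of finite type elements\<close>

definition complex_subalgebra :: "'a::unital_cstar_algebra set \<Rightarrow> bool" where
  "complex_subalgebra S \<longleftrightarrow> 0 \<in> S \<and> (\<forall>x\<in>S. \<forall>y\<in>S. x + y \<in> S \<and> x * y \<in> S) \<and>
     (\<forall>c. \<forall>x\<in>S. c *\<^sub>C x \<in> S)"

text \<open>A net enters the notion of an approximate unit only through the filter generated by the
  images of its tails, and conversely every proper filter arises from a net in this way.
  Approximate units contained in \<open>F\<close> and consisting of projections are therefore represented by
  filters on the algebra; the net is not required to be increasing.\<close>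

definition projection_approximate_unit ::
    "'a::unital_cstar_algebra set \<Rightarrow> 'a filter \<Rightarrow> bool" where
  "projection_approximate_unit F U \<longleftrightarrow>
     U \<noteq> bot \<and> (\<forall>\<^sub>F p in U. p \<in> F \<and> is_projection p) \<and>
     (\<forall>x\<in>F. ((\<lambda>p. p * x) \<longlongrightarrow> x) U \<and> ((\<lambda>p. x * p) \<longlongrightarrow> x) U)"

definition finite_type_ideal :: "'a::unital_cstar_algebra set \<Rightarrow> bool" where
  "finite_type_ideal F \<longleftrightarrow>
     complex_subalgebra F \<and>
     (\<forall>x\<in>F. star x \<in> F \<and> (\<forall>a. a * x \<in> F \<and> x * a \<in> F)) \<and>
     (\<exists>U. projection_approximate_unit F U) \<and>
     (\<forall>p\<in>F. \<forall>q\<in>F. is_projection p \<and> is_projection q \<longrightarrow>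
        (\<exists>v. v * star v = q \<and> is_projection (star v * v + p)))"


section \<open>The algebra as a right Hilbert module over itself\<close>

definition mod_inner :: "'a::unital_cstar_algebra \<Rightarrow> 'a \<Rightarrow> 'a" where
  "mod_inner x y = star x * y"

text \<open>As the algebra is unital, complex scalars act through right multiplication by
  \<open>c *\<^sub>C 1\<close>; real linearity, respectively additivity, together with compatibility with right
  multiplication therefore already gives complex linearity below.\<close>

definition module_operators :: "('a::unital_cstar_algebra \<Rightarrow>\<^sub>L 'a) set" where
  "module_operators = {T. \<forall>x a. blinfun_apply T (x * a) = blinfun_apply T x * a}"

lift_definition left_mult :: "'a::unital_cstar_algebra \<Rightarrow> 'a \<Rightarrow>\<^sub>L 'a" is "\<lambda>a x. a * x"
  by (rule bounded_linear_mult_right)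

definition closed_submodule :: "'a::unital_cstar_algebra set \<Rightarrow> bool" where
  "closed_submodule M \<longleftrightarrow>
     closed M \<and> 0 \<in> M \<and> (\<forall>x\<in>M. \<forall>y\<in>M. x + y \<in> M) \<and> (\<forall>x\<in>M. \<forall>a. x * a \<in> M)"

definition direct_decomposition ::
    "'a::unital_cstar_algebra set \<Rightarrow> 'a set \<Rightarrow> bool" where
  "direct_decomposition M N \<longleftrightarrow> closed_submodule M \<and> closed_submodule N \<and>
     M \<inter> N = {0} \<and> {x + y |x y. x \<in> M \<and> y \<in> N} = UNIV"

definition is_orth_projection_onto ::
    "('a::unital_cstar_algebra \<Rightarrow>\<^sub>L 'a) \<Rightarrow> 'a set \<Rightarrow> bool" where
  "is_orth_projection_onto P M \<longleftrightarrow> P \<in> module_operators \<and>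
     (\<forall>x. blinfun_apply P x \<in> M \<and> (\<forall>y\<in>M. mod_inner y (x - blinfun_apply P x) = 0))"

text \<open>\<open>P\<^sub>M\<close> lies in the image of \<open>F\<close> under the identification of the algebra with the
  module operators.\<close>

definition orth_projection_in ::
    "'a::unital_cstar_algebra set \<Rightarrow> 'a set \<Rightarrow> bool" where
  "orth_projection_in F M \<longleftrightarrow> (\<exists>P \<in> left_mult ` F. is_orth_projection_onto P M)"

definition bounded_module_map ::
    "'a::unital_cstar_algebra set \<Rightarrow> 'a set \<Rightarrow> ('a \<Rightarrow> 'a) \<Rightarrow> bool" where
  "bounded_module_map M N f \<longleftrightarrow>
     (\<forall>x\<in>M. f x \<in> N) \<and> (\<forall>x\<in>M. \<forall>y\<in>M. f (x + y) = f x + f y) \<and>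
     (\<forall>x\<in>M. \<forall>a. f (x * a) = f x * a) \<and> (\<exists>K. \<forall>x\<in>M. norm (f x) \<le> K * norm x)"

definition module_iso ::
    "'a::unital_cstar_algebra set \<Rightarrow> 'a set \<Rightarrow> ('a \<Rightarrow> 'a) \<Rightarrow> bool" where
  "module_iso M N f \<longleftrightarrow> bij_betw f M N \<and> bounded_module_map M N f \<and>
     bounded_module_map N M (inv_into M f)"

definition isomorphic_modules ::
    "'a::unital_cstar_algebra set \<Rightarrow> 'a set \<Rightarrow> bool" (infix \<open>\<cong>\<^sub>m\<close> 50) where
  "M \<cong>\<^sub>m N \<longleftrightarrow> (\<exists>f. module_iso M N f)"

definition sub_isomorphic_modules ::
    "'a::unital_cstar_algebra set \<Rightarrow> 'a set \<Rightarrow> bool" (infix \<open>\<preceq>\<^sub>m\<close> 50) where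
  "M \<preceq>\<^sub>m N \<longleftrightarrow> (\<exists>K. closed_submodule K \<and> K \<subseteq> N \<and> M \<cong>\<^sub>m K)"


section \<open>Generalized semi-Fredholm operators\<close>

text \<open>\<open>T\<close> is diagonal with respect to \<open>M1 \<oplus> N1\<close> and \<open>M2 \<oplus> N2\<close>, with its upper left entry
  an isomorphism.\<close>

definition iso_decomposition ::
    "('a::unital_cstar_algebra \<Rightarrow>\<^sub>L 'a) \<Rightarrow> 'a set \<Rightarrow> 'a set \<Rightarrow> 'a set \<Rightarrow> 'a set \<Rightarrow> bool" where
  "iso_decomposition T M1 N1 M2 N2 \<longleftrightarrow>
     direct_decomposition M1 N1 \<and> direct_decomposition M2 N2 \<and>
     blinfun_apply T ` M1 \<subseteq> M2 \<and> blinfun_apply T ` N1 \<subseteq> N2 \<and>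
     module_iso M1 M2 (blinfun_apply T)"

definition MKPhi_plus ::
    "'a::unital_cstar_algebra set \<Rightarrow> ('a \<Rightarrow>\<^sub>L 'a) set" where
  "MKPhi_plus F = {T \<in> module_operators. \<exists>M1 N1 M2 N2.
     iso_decomposition T M1 N1 M2 N2 \<and> orth_projection_in F N1}"

definition MKPhi_minus ::
    "'a::unital_cstar_algebra set \<Rightarrow> ('a \<Rightarrow>\<^sub>L 'a) set" where
  "MKPhi_minus F = {T \<in> module_operators. \<exists>M1 N1 M2 N2.
     iso_decomposition T M1 N1 M2 N2 \<and> orth_projection_in F N2}"

definition MKPhi ::
    "'a::unital_cstar_algebra set \<Rightarrow> ('a \<Rightarrow>\<^sub>L 'a) set" where
  "MKPhi F = {T \<in> module_operators. \<exists>M1 N1 M2 N2.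
     iso_decomposition T M1 N1 M2 N2 \<and> orth_projection_in F N1 \<and> orth_projection_in F N2}"

definition MKPhi_plus_minus' ::
    "'a::unital_cstar_algebra set \<Rightarrow> ('a \<Rightarrow>\<^sub>L 'a) set" where
  "MKPhi_plus_minus' F = {T \<in> module_operators. \<exists>M1 N1 M2 N2.
     iso_decomposition T M1 N1 M2 N2 \<and> orth_projection_in F N1 \<and> N1 \<preceq>\<^sub>m N2}"

definition MKPhi_minus_plus' ::
    "'a::unital_cstar_algebra set \<Rightarrow> ('a \<Rightarrow>\<^sub>L 'a) set" where
  "MKPhi_minus_plus' F = {T \<in> module_operators. \<exists>M1 N1 M2 N2.
     iso_decomposition T M1 N1 M2 N2 \<and> orth_projection_in F N2 \<and> N2 \<preceq>\<^sub>m N1}"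

definition MKPhi_0 ::
    "'a::unital_cstar_algebra set \<Rightarrow> ('a \<Rightarrow>\<^sub>L 'a) set" where
  "MKPhi_0 F = {T \<in> module_operators. \<exists>M1 N1 M2 N2.
     iso_decomposition T M1 N1 M2 N2 \<and> orth_projection_in F N1 \<and> orth_projection_in F N2 \<and>
     N1 \<cong>\<^sub>m N2}"

end

theory Submission
  imports Defs
begin

text \<open>
  An operator \<open>T\<close> is left multiplication by \<open>t = T 1\<close>, and a decomposition with invertible corner is
  the same thing as an element \<open>s\<close> with \<open>s * t * s = s\<close>: the complements \<open>N1\<close> and \<open>N2\<close> are the ranges
  of the idempotents \<open>1 - s * t\<close> and \<open>1 - t * s\<close>
  (\<open>decomposition_outer_inverse\<close>, \<open>outer_inverse_decomposition\<close>). By Kaplansky's formula the range of an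
  idempotent has its orthogonal projection in the ideal \<open>F\<close> exactly if the idempotent lies in \<open>F\<close>.
  Isomorphism of complements becomes algebraic equivalence of idempotents, and \<open>N1 \<preceq>\<^sub>m N2\<close> becomes the
  existence of a left multiplication from one to the other that is bounded below. The six classes of
  operators are thereby described inside the algebra (\<open>MKPhi_characterizations\<close>).

  The three larger classes are stable under perturbations \<open>t'\<close> of \<open>t\<close> with
  \<open>norm s * norm (t' - t) < 1\<close>, by a Neumann series. It remains to see that, within this distance, if
  \<open>t'\<close> belongs to the smaller class then so does \<open>t\<close>. This is an index argument: \<open>t'\<close> has
  one decomposition inherited from \<open>t\<close> and one that witnesses the smaller class, and the two have to be
  compared. A projection \<open>p\<close> from the approximate unit that almost fixes the finite complements of all
  decompositions involved allows each of them to be enlarged to one whose finite complement is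
  equivalent to \<open>p\<close> (\<open>outer_inverse_enlarge\<close>). The enlargement adds the same summand to both complements,
  so it preserves \<open>N1 \<preceq>\<^sub>m N2\<close> and \<open>N1 \<cong>\<^sub>m N2\<close>; and after it the remaining
  complements of the different decompositions are isomorphic (\<open>common_enlargement\<close>). Hence the relation
  moves from the given decomposition of \<open>t'\<close> to an enlarged decomposition of \<open>t\<close>. The case in which
  \<open>N2\<close> is the finite complement follows by taking adjoints.
\<close>

section \<open>Inverses and range projections\<close>

lemma neumann_inverse:
  fixes x :: "'a::{real_normed_algebra_1,banach}"
  assumes "norm x < 1"
  obtains r where "r * (1 - x) = 1" "(1 - x) * r = 1"
proof -
  define r where "r = (\<Sum>n. x ^ n)"
  have sm: "summable (\<lambda>n. x ^ n)"
    using complete_algebra_summable_geometric[OF assms] .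
  have tail: "(\<Sum>n. x ^ Suc n) = r - 1"
    using suminf_split_head[OF sm] by (simp add: r_def)
  have "x * r = r - 1"
    using suminf_mult[OF sm, of x] tail by (simp add: r_def)
  moreover have "r * x = r - 1"
    using suminf_mult2[OF sm, of x] tail by (simp add: r_def power_commutes)
  ultimately show ?thesis
    by (intro that[of r]) (auto simp: algebra_simps)
qed

lemma star_zero [simp]: "star (0::'a::unital_cstar_algebra) = 0"
  using star_add[of "0::'a" 0] by simp

lemma star_minus: "star (- x) = - star (x::'a::unital_cstar_algebra)"
  using star_add[of x "- x"] by (simp add: eq_neg_iff_add_eq_0 add.commute)

lemma star_diff: "star (x - y) = star x - star (y::'a::unital_cstar_algebra)"
  using star_add[of x "- y"] by (simp add: star_minus)

lemma star_one [simp]: "star (1::'a::unital_cstar_algebra) = 1"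
  by (metis mult.right_neutral mult.left_neutral star_mult star_star)

lemma star_scaleR: "star (r *\<^sub>R x) = r *\<^sub>R star (x::'a::unital_cstar_algebra)"
  using star_scaleC[of "complex_of_real r" x] by (simp add: scaleC_of_real)

lemma star_mult_self_eq_0: "star x * x = 0 \<Longrightarrow> x = (0::'a::unital_cstar_algebra)"
  using cstar_identity[of x] by simp

lemma norm_star: "norm (star x) = norm (x::'a::unital_cstar_algebra)"
proof -
  have le: "norm y \<le> norm (star y)" for y :: 'a
  proof (cases "y = 0")
    case False
    have "norm y * norm y \<le> norm (star y) * norm y"
      using norm_mult_ineq[of "star y" y] by (simp add: cstar_identity power2_eq_square)
    then show ?thesis using False by simp
  qed simp
  show ?thesis using le[of x] le[of "star x"] by (simp add: star_star)
qed

text \<open>This is an elementary instance of the fact that a skew-adjoint element has imaginary spectrum.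
  The element \<open>1 + b\<close> need not be close to \<open>1\<close>, but after a shift by a large real number \<open>m\<close> it is
  \<open>(1 + m) - (m - b)\<close>, and the C*-identity gives \<open>norm (m - b)\<^sup>2 \<le> m\<^sup>2 + (norm b)\<^sup>2\<close>, which is
  below \<open>(1 + m)\<^sup>2\<close>. A Neumann series then applies.\<close>

lemma one_plus_skew_invertible:
  fixes b :: "'a::unital_cstar_algebra"
  assumes skew: "star b = - b"
  obtains r where "r * (1 + b) = 1" "(1 + b) * r = 1"
proof -
  define m where "m = (norm b)\<^sup>2 + 1"
  have m: "m > 0" by (simp add: m_def add_nonneg_pos)
  define y where "y = m *\<^sub>R 1 - b"
  have "(norm y)\<^sup>2 = norm (star y * y)" by (simp add: cstar_identity)
  also have "star y * y = (m\<^sup>2) *\<^sub>R 1 - b * b"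
    by (simp add: y_def star_diff star_scaleR skew algebra_simps power2_eq_square)
  also have "norm \<dots> \<le> norm ((m\<^sup>2) *\<^sub>R (1::'a)) + norm (b * b)"
    by (rule norm_triangle_ineq4)
  also have "\<dots> \<le> m\<^sup>2 + (norm b)\<^sup>2"
    using norm_mult_ineq[of b b] by (simp add: power2_eq_square)
  also have "\<dots> < (1 + m)\<^sup>2"
    using m by (simp add: m_def power2_eq_square algebra_simps)
  finally have "norm y < 1 + m"
    using m by (simp add: power_less_imp_less_base)
  then have "norm ((1 / (1 + m)) *\<^sub>R y) < 1" using m by simp
  then obtain r where r: "r * (1 - (1 / (1 + m)) *\<^sub>R y) = 1" "(1 - (1 / (1 + m)) *\<^sub>R y) * r = 1"
    by (rule neumann_inverse)
  have "(1 + m) *\<^sub>R (1 - (1 / (1 + m)) *\<^sub>R y) = (1 + m) *\<^sub>R 1 - y"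
    using m by (simp add: scaleR_diff_right)
  then have e: "1 + b = (1 + m) *\<^sub>R (1 - (1 / (1 + m)) *\<^sub>R y)"
    by (simp add: y_def scaleR_add_left)
  show ?thesis
    by (rule that[of "(1 / (1 + m)) *\<^sub>R r"]) (use m r in \<open>simp_all add: e\<close>)
qed

text \<open>Kaplansky's formula: \<open>z = 1 - (f - star f)\<^sup>2\<close> commutes with \<open>f\<close> and \<open>star f\<close>, satisfies
  \<open>f * z = f * star f * f\<close>, and factors as \<open>(1 - b) * (1 + b)\<close> with \<open>b = f - star f\<close>
  skew-adjoint, so it is invertible. The projection is \<open>f * star f * inverse z\<close>. It lies in every
  ideal that contains \<open>f\<close>, which is why membership of idempotents in \<open>F\<close> is the same as membership
  of orthogonal projections.\<close>

lemma range_projection_exists: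
  fixes f :: "'a::unital_cstar_algebra"
  assumes idem: "f * f = f"
  obtains p where "is_projection p" "p * f = f" "f * p = p"
proof -
  define b where "b = f - star f"
  define z where "z = (1 - b) * (1 + b)"
  have skew: "star b = - b" "star (- b) = - (- b)"
    by (simp_all add: b_def star_diff star_star star_minus)
  obtain r1 where r1: "r1 * (1 + b) = 1" "(1 + b) * r1 = 1"
    using one_plus_skew_invertible[OF skew(1)] by blast
  obtain r2 where "r2 * (1 + (- b)) = 1" "(1 + (- b)) * r2 = 1"
    using one_plus_skew_invertible[OF skew(2)] by blast
  then have r2: "r2 * (1 - b) = 1" "(1 - b) * r2 = 1" by simp_all
  define y where "y = r1 * r2"
  have yz: "y * z = 1"
  proof -
    have "y * z = r1 * (r2 * (1 - b)) * (1 + b)" by (simp add: y_def z_def mult.assoc)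
    then show ?thesis using r1 r2 by simp
  qed
  have zy: "z * y = 1"
  proof -
    have "z * y = (1 - b) * ((1 + b) * r1) * r2" by (simp add: y_def z_def mult.assoc)
    then show ?thesis using r1 r2 by simp
  qed
  have idem': "f * (f * x) = f * x" for x
    by (simp add: idem flip: mult.assoc)
  have sidem: "star f * star f = star f" using idem by (metis star_mult)
  have sidem': "star f * (star f * x) = star f * x" for x
    by (simp add: sidem flip: mult.assoc)
  have z: "z = 1 - f - star f + f * star f + star f * f"
    by (simp add: z_def b_def algebra_simps idem sidem)
  have fz: "f * z = f * star f * f" and zf: "z * f = f * star f * f"
    by (simp_all add: z algebra_simps idem sidem idem' sidem')
  have sz: "star z = z" by (simp add: z star_add star_diff star_mult star_star)
  have sy: "star y = y"
    by (metis mult.left_neutral mult.right_neutral mult.assoc star_mult star_one sz yz zy)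
  have comm: "y * g = g * y" if "z * g = g * z" for g
    by (metis that mult.left_neutral mult.right_neutral mult.assoc yz zy)
  have yf: "y * f = f * y" using fz zf by (intro comm) simp
  have ysf: "y * star f = star f * y" by (metis yf star_mult sy)
  define p where "p = f * star f * y"
  have pf: "p * f = f"
  proof -
    have "p * f = f * star f * f * y" by (simp add: p_def mult.assoc yf)
    also have "\<dots> = f * z * y" by (simp only: fz)
    also have "\<dots> = f * (z * y)" by (simp only: mult.assoc)
    finally show ?thesis by (simp add: zy)
  qed
  have fp: "f * p = p" by (simp add: p_def idem flip: mult.assoc)
  have sp: "star p = p"
    by (simp add: p_def star_mult star_star sy) (simp add: yf ysf flip: mult.assoc, simp add: ysf mult.assoc)
  have "p * p = p" 
  proof -
    have "p * p = p * f * (star f * y)" by (simp add: p_def mult.assoc)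
    also have "\<dots> = p" using pf by (simp add: p_def mult.assoc)
    finally show ?thesis .
  qed
  then show ?thesis using that pf fp sp by (simp add: is_projection_def)
qed

section \<open>Comparison of idempotents\<close>

text \<open>Algebraic Murray-von Neumann equivalence of idempotents, which amounts to isomorphism of the right
  modules that they generate. No selfadjointness is asked for, so that the complements of a
  non-orthogonal decomposition can be compared directly.\<close>

definition mvn :: "'a::ring_1 \<Rightarrow> 'a \<Rightarrow> bool" (infix \<open>\<approx>\<^sub>v\<close> 50) where
  "e \<approx>\<^sub>v f \<longleftrightarrow> e * e = e \<and> f * f = f \<and> (\<exists>x y. x * y = e \<and> y * x = f)"

lemma mvnI: "x * y = e \<Longrightarrow> y * x = f \<Longrightarrow> e * e = e \<Longrightarrow> f * f = f \<Longrightarrow> e \<approx>\<^sub>v f"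
  by (auto simp: mvn_def)

lemma mvn_sym: "e \<approx>\<^sub>v f \<Longrightarrow> f \<approx>\<^sub>v e"
  by (auto simp: mvn_def)

text \<open>Replacing \<open>x\<close> by \<open>x * y * x\<close> and \<open>y\<close> by \<open>y * x * y\<close> moves the witnesses into the
  corners where they compose like module maps.\<close>

lemma mvn_normalized:
  assumes "e \<approx>\<^sub>v f"
  obtains x y where "x * y = e" "y * x = f" "e * x = x" "x * f = x" "f * y = y" "y * e = y"
proof -
  obtain x y where xy: "x * y = e" "y * x = f" and i: "e * e = e" "f * f = f"
    using assms by (auto simp: mvn_def)
  have xf: "x * f = e * x" and ye: "y * e = f * y" by (simp_all flip: xy add: mult.assoc)
  have i': "e * (e * a) = e * a" "f * (f * a) = f * a" for a
    by (simp_all add: i flip: mult.assoc)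
  show ?thesis
  proof (rule that[of "e * x" "f * y"])
    have "e * x * (f * y) = x * f * (f * y)" by (simp only: xf)
    also have "\<dots> = x * f * y" by (simp add: i' mult.assoc)
    also have "\<dots> = e * x * y" by (simp only: xf)
    also have "\<dots> = e" by (simp add: mult.assoc xy i)
    finally show "e * x * (f * y) = e" .
    have "f * y * (e * x) = y * e * (e * x)" by (simp only: ye)
    also have "\<dots> = y * e * x" by (simp add: i' mult.assoc)
    also have "\<dots> = f * y * x" by (simp only: ye)
    also have "\<dots> = f" by (simp add: mult.assoc xy i)
    finally show "f * y * (e * x) = f" .
  qed (simp_all add: mult.assoc xf ye i i')
qed

lemma mvn_trans:
  assumes "e \<approx>\<^sub>v f" "f \<approx>\<^sub>v g"
  shows "e \<approx>\<^sub>v g"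
proof -
  obtain x y where xy: "x * y = e" "y * x = f" "x * f = x" "f * y = y"
    using assms(1) by (rule mvn_normalized)
  obtain x' y' where xy': "x' * y' = f" "y' * x' = g" "f * x' = x'" "y' * f = y'"
    using assms(2) by (rule mvn_normalized)
  have "x * x' * (y' * y) = x * (x' * y') * y" by (simp add: mult.assoc)
  then have 1: "x * x' * (y' * y) = e" by (simp add: xy xy')
  have "y' * y * (x * x') = y' * (y * x) * x'" by (simp add: mult.assoc)
  then have 2: "y' * y * (x * x') = g" by (simp add: xy xy')
  show ?thesis using mvnI[OF 1 2] assms by (simp add: mvn_def)
qed

text \<open>The hypotheses say that \<open>e\<close> and \<open>f\<close> have the same range; in the next lemma they say that the
  kernels agree, so that the two ranges are complements of one and the same submodule.\<close>

lemma mvn_same_range: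
  assumes "e * f = f" "f * e = e"
  shows "e \<approx>\<^sub>v f"
proof (rule mvnI[of f e])
  show "e * e = e" by (metis assms mult.assoc)
  show "f * f = f" by (metis assms mult.assoc)
qed (fact assms)+

lemma mvn_same_kernel:
  assumes "e * f = e" "f * e = f"
  shows "e \<approx>\<^sub>v f"
proof (rule mvnI[of e f])
  show "e * e = e" by (metis assms mult.assoc)
  show "f * f = f" by (metis assms mult.assoc)
qed (fact assms)+

lemma mvn_conjugate:
  assumes "w * w' = 1" "w' * w = 1" "e * e = e"
  shows "e \<approx>\<^sub>v w * e * w'"
proof (rule mvnI[of "e * w'" "w * e"])
  show 1: "e * w' * (w * e) = e" by (metis assms mult.assoc mult.left_neutral)
  show "w * e * (e * w') = w * e * w'" by (metis assms(3) mult.assoc)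
  show "w * e * w' * (w * e * w') = w * e * w'" by (metis 1 assms(3) mult.assoc)
qed (fact assms)

lemma mvn_add:
  assumes "e \<approx>\<^sub>v f" "k \<approx>\<^sub>v l" "e * k = 0" "k * e = 0" "f * l = 0" "l * f = 0"
  shows "e + k \<approx>\<^sub>v f + l"
proof -
  obtain x y where xy: "x * y = e" "y * x = f" "e * x = x" "x * f = x" "f * y = y" "y * e = y"
    using assms(1) by (rule mvn_normalized)
  obtain x' y' where xy': "x' * y' = k" "y' * x' = l" "k * x' = x'" "x' * l = x'" "l * y' = y'" "y' * k = y'"
    using assms(2) by (rule mvn_normalized)
  have z: "x * y' = 0" "x' * y = 0" "y * x' = 0" "y' * x = 0"
    by (metis assms xy xy' mult.assoc mult_zero_left mult_zero_right)+
  show ?thesis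
    by (rule mvnI[of "x + x'" "y + y'"])
      (use assms in \<open>simp_all add: xy xy' z mvn_def algebra_simps\<close>)
qed

lemma mvn_star: "e \<approx>\<^sub>v f \<Longrightarrow> star e \<approx>\<^sub>v star (f::'a::unital_cstar_algebra)"
  unfolding mvn_def by (metis star_mult)

text \<open>The right module of \<open>e\<close> is isomorphic, through left multiplication by \<open>x\<close>, to a closed submodule
  of that of \<open>f\<close>. The image need not be given by an idempotent, hence a lower bound for \<open>x\<close> instead
  of an equation with a left inverse.\<close>

definition embeds :: "'a::real_normed_algebra_1 \<Rightarrow> 'a \<Rightarrow> bool" where
  "embeds e f \<longleftrightarrow> (\<exists>x c. c > 0 \<and> f * x = x \<and> (\<forall>a. e * a = a \<longrightarrow> c * norm a \<le> norm (x * a)))"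

lemma embeds_mvn_cong:
  assumes "embeds e f" "e \<approx>\<^sub>v e'" "f \<approx>\<^sub>v f'"
  shows "embeds e' f'"
proof -
  obtain x c where x: "c > 0" "f * x = x" "\<And>a. e * a = a \<Longrightarrow> c * norm a \<le> norm (x * a)"
    using assms(1) by (auto simp: embeds_def)
  obtain u v where uv: "u * v = e" "v * u = e'" "e * u = u" "u * e' = u" 
    using assms(2) by (rule mvn_normalized)
  obtain y z where yz: "y * z = f" "z * y = f'" "f' * z = z"
    using assms(3) by (rule mvn_normalized)
  define C where "C = norm v * norm y + 1"
  have C: "C > 0" by (simp add: C_def add_nonneg_pos)
  have "c / C * norm a \<le> norm (z * x * u * a)" if a: "e' * a = a" for a
  proof -
    have "a = v * (u * a)" using a uv by (simp flip: mult.assoc)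
    then have 1: "norm a \<le> norm v * norm (u * a)" by (metis norm_mult_ineq)
    have 2: "c * norm (u * a) \<le> norm (x * (u * a))"
      by (rule x) (simp add: uv flip: mult.assoc)
    have "x * (u * a) = y * (z * x * u * a)"
      using x yz by (simp flip: mult.assoc)
    then have 3: "norm (x * (u * a)) \<le> norm y * norm (z * x * u * a)" by (metis norm_mult_ineq)
    have "c * norm a \<le> norm v * (c * norm (u * a))"
      using 1 x(1) by (metis mult.left_commute mult_left_mono less_imp_le)
    also have "\<dots> \<le> norm v * (norm y * norm (z * x * u * a))"
      using 2 3 by (intro mult_left_mono) auto
    also have "\<dots> \<le> C * norm (z * x * u * a)"
      by (simp add: C_def algebra_simps)
    finally show ?thesis using C by (simp add: field_simps)
  qed
  moreover have "f' * (z * x * u) = z * x * u" using yz by (simp flip: mult.assoc)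
  ultimately show ?thesis using x(1) C unfolding embeds_def
    by (intro exI[of _ "z * x * u"] exI[of _ "c / C"]) auto
qed

text \<open>The map \<open>x * e + y\<close> is bounded below because its two components are recovered
  by multiplying from the left with \<open>f\<close> and with an inverse of \<open>y\<close>.\<close>

lemma embeds_add:
  assumes "embeds e f" "k \<approx>\<^sub>v l" "e * e = e" "f * f = f"
    "e * k = 0" "k * e = 0" "f * l = 0" "l * f = 0"
  shows "embeds (e + k) (f + l)"
proof -
  obtain x c where x: "c > 0" "f * x = x" "\<And>a. e * a = a \<Longrightarrow> c * norm a \<le> norm (x * a)"
    using assms(1) by (auto simp: embeds_def)
  obtain y z where yz: "y * z = l" "z * y = k" "l * y = y" "z * l = z" "y * k = y"
    by (rule mvn_normalized[OF mvn_sym[OF assms(2)]]) 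
  have o: "f * y = 0" "z * x = 0" "l * x = 0" "y * e = 0"
    by (metis assms(5-8) x yz mult.assoc mult_zero_left mult_zero_right)+
  define C where "C = norm f / c + norm z + 1"
  have C: "C > 0" using x(1) by (simp add: C_def add_nonneg_pos)
  define X where "X = x * e + y"
  have "1 / C * norm a \<le> norm (X * a)" if a: "(e + k) * a = a" for a
  proof -
    have "f * (X * a) = x * (e * a)"
      by (simp add: X_def algebra_simps o x(2) flip: mult.assoc)
    then have "c * norm (e * a) \<le> norm f * norm (X * a)"
      using x(3)[of "e * a"] assms(3) norm_mult_ineq[of f "X * a"] by (simp flip: mult.assoc)
    then have 1: "norm (e * a) \<le> norm f / c * norm (X * a)"
      using x(1) by (simp add: field_simps)
    have "z * (X * a) = k * a"
      by (simp add: X_def algebra_simps o yz flip: mult.assoc)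
    then have 2: "norm (k * a) \<le> norm z * norm (X * a)" by (metis norm_mult_ineq)
    have "norm a \<le> norm (e * a) + norm (k * a)"
      by (metis a distrib_right norm_triangle_ineq)
    also have "\<dots> \<le> C * norm (X * a)"
      using 1 2 norm_ge_zero[of "X * a"] unfolding C_def distrib_right mult_1_left by linarith
    finally show ?thesis using C by (simp add: field_simps)
  qed
  moreover have "(f + l) * X = X"
    by (simp add: X_def algebra_simps o yz x(2) flip: mult.assoc)
  ultimately show ?thesis using C unfolding embeds_def
    by (intro exI[of _ X] exI[of _ "1 / C"]) auto
qed

text \<open>Up to isomorphism, \<open>e'\<close> and \<open>f'\<close> arise from \<open>e\<close> and \<open>f\<close> by adding one and the same direct
  summand. Enlarging the finite part of a decomposition changes the pair of complements in this
  way, and any relation between \<open>e\<close> and \<open>f\<close> that survives common summands passes to \<open>e'\<close> and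
  \<open>f'\<close>. The relation is preserved by \<open>star\<close> because it only involves equivalences.\<close>

definition stabilises :: "'a::ring_1 \<Rightarrow> 'a \<Rightarrow> 'a \<Rightarrow> 'a \<Rightarrow> bool" where
  "stabilises e f e' f' \<longleftrightarrow> (\<exists>j1 k1 j2 k2. e \<approx>\<^sub>v j1 \<and> f \<approx>\<^sub>v j2 \<and> k1 \<approx>\<^sub>v k2 \<and>
     j1 * k1 = 0 \<and> k1 * j1 = 0 \<and> j2 * k2 = 0 \<and> k2 * j2 = 0 \<and>
     j1 + k1 \<approx>\<^sub>v e' \<and> j2 + k2 \<approx>\<^sub>v f')"

lemma stabilises_mvn_cong:
  "stabilises e f e' f' \<Longrightarrow> e' \<approx>\<^sub>v e'' \<Longrightarrow> f' \<approx>\<^sub>v f'' \<Longrightarrow> stabilises e f e'' f''"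
  unfolding stabilises_def by (blast intro: mvn_trans)

lemma stabilises_star:
  fixes e :: "'a::unital_cstar_algebra"
  assumes "stabilises e f e' f'"
  shows "stabilises (star e) (star f) (star e') (star f')"
proof -
  obtain j1 k1 j2 k2 where "e \<approx>\<^sub>v j1" "f \<approx>\<^sub>v j2" "k1 \<approx>\<^sub>v k2" "j1 * k1 = 0" "k1 * j1 = 0"
    "j2 * k2 = 0" "k2 * j2 = 0" "j1 + k1 \<approx>\<^sub>v e'" "j2 + k2 \<approx>\<^sub>v f'"
    using assms unfolding stabilises_def by blast
  then show ?thesis unfolding stabilises_def
    by (intro exI[of _ "star j1"] exI[of _ "star k1"] exI[of _ "star j2"] exI[of _ "star k2"])
      (auto simp flip: star_mult star_add intro: mvn_star)
qed

lemma stabilises_mvn: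
  assumes "stabilises e f e' f'" "e \<approx>\<^sub>v f"
  shows "e' \<approx>\<^sub>v f'"
  using assms unfolding stabilises_def by (meson mvn_add mvn_sym mvn_trans)

lemma stabilises_embeds:
  assumes "stabilises e f e' f'" "embeds e f"
  shows "embeds e' f'"
proof -
  obtain j1 k1 j2 k2 where h: "e \<approx>\<^sub>v j1" "f \<approx>\<^sub>v j2" "k1 \<approx>\<^sub>v k2" "j1 * k1 = 0" "k1 * j1 = 0"
    "j2 * k2 = 0" "k2 * j2 = 0" "j1 + k1 \<approx>\<^sub>v e'" "j2 + k2 \<approx>\<^sub>v f'"
    using assms unfolding stabilises_def by blast
  have "embeds (j1 + k1) (j2 + k2)"
    using h by (intro embeds_add embeds_mvn_cong[OF assms(2)]) (auto simp: mvn_def)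
  then show ?thesis using h by (blast intro: embeds_mvn_cong)
qed

section \<open>Outer inverses\<close>

lemma outer_inverse_idempotent:
  fixes s t :: "'a::ring_1"
  assumes "s * t * s = s"
  shows "(1 - s * t) * (1 - s * t) = 1 - s * t" "(1 - t * s) * (1 - t * s) = 1 - t * s"
proof -
  have "s * t * (s * t) = s * t" "t * s * (t * s) = t * s"
    by (metis assms mult.assoc)+
  then show "(1 - s * t) * (1 - s * t) = 1 - s * t" "(1 - t * s) * (1 - t * s) = 1 - t * s"
    by (simp_all add: left_diff_distrib right_diff_distrib)
qed

text \<open>Conjugating with the invertible elements \<open>1 + s * d\<close> and \<open>1 + d * s\<close>
  carries a decomposition of \<open>t\<close> into one of \<open>t + d\<close>: the two are linked by
  \<open>(1 + s * d) * s = s * (1 + d * s)\<close>. The formulas for the complementary idempotents show that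
  they stay in any ideal that contained them.\<close>

lemma outer_inverse_perturb:
  fixes s t d :: "'a::{real_normed_algebra_1,banach}"
  assumes s: "s * t * s = s" and small: "norm s * norm d < 1"
  obtains u w s' where "w * (1 + d * s) = 1" "(1 + d * s) * w = 1"
    "s' = s * w" "s' * (t + d) * s' = s'"
    "1 - s' * (t + d) = u * (1 - s * t)" "1 - (t + d) * s' = (1 - t * s) * w"
proof -
  have "norm (- (s * d)) < 1" using small norm_mult_ineq[of s d] by simp
  then obtain u where "u * (1 - - (s * d)) = 1" "(1 - - (s * d)) * u = 1" by (rule neumann_inverse)
  then have u: "u * (1 + s * d) = 1" "(1 + s * d) * u = 1" by simp_all
  have "norm (- (d * s)) < 1" using small norm_mult_ineq[of d s] by (simp add: mult.commute)
  then obtain w where "w * (1 - - (d * s)) = 1" "(1 - - (d * s)) * w = 1" by (rule neumann_inverse)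
  then have w: "w * (1 + d * s) = 1" "(1 + d * s) * w = 1" by simp_all
  have us: "u * s = s * w"
  proof -
    have "(1 + s * d) * s = s * (1 + d * s)" by (simp add: algebra_simps)
    then have "u * ((1 + s * d) * s) * w = u * (s * (1 + d * s)) * w" by simp
    then show ?thesis using u w by (simp add: mult.assoc) (simp flip: mult.assoc)
  qed
  have l: "1 - u * s * (t + d) = u * (1 - s * t)"
  proof -
    have "u * s * (t + d) = u * (1 + s * d) - u * (1 - s * t)" by (simp add: algebra_simps)
    then show ?thesis by (simp add: u)
  qed
  have r: "1 - (t + d) * (s * w) = (1 - t * s) * w"
  proof -
    have "(t + d) * (s * w) = (1 + d * s) * w - (1 - t * s) * w" by (simp add: algebra_simps)
    then show ?thesis by (simp add: w)
  qed
  have "(1 - u * s * (t + d)) * (u * s) = u * ((1 - s * t) * s) * w"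
    unfolding l by (simp add: us mult.assoc)
  also have "\<dots> = 0" using s by (simp add: left_diff_distrib)
  finally have "u * s * (t + d) * (u * s) = u * s" by (simp add: left_diff_distrib)
  then show ?thesis using that[OF w refl, of u] l r us by simp
qed

text \<open>If \<open>p\<close> almost acts as a left unit on \<open>f = 1 - s * t\<close>, then with \<open>q = 1 - p\<close> the
  operator \<open>q * s * t * q\<close> is a small perturbation of \<open>q\<close>, so \<open>t\<close> is bounded below on the range
  of \<open>q\<close>, and \<open>q * s\<close>, corrected by the inverse \<open>r\<close> of \<open>1 - q * f\<close>, is a new outer inverse. The
  complement of its range is equivalent to \<open>p\<close>, the complement in the codomain is the kernel of
  \<open>q * s\<close>. Both split off the old complement: the range of \<open>f\<close> embeds into that of \<open>p\<close> and what
  is left there is the intersection of the range of \<open>p\<close> with the kernel of \<open>f\<close>; the kernel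
  of \<open>q * s\<close> contains the kernel of \<open>s\<close>, and \<open>s\<close> maps a complement of the latter onto the same
  intersection.\<close>

lemma outer_inverse_enlarge:
  fixes s t p :: "'a::{real_normed_algebra_1,banach}"
  assumes s: "s * t * s = s" and p: "p * p = p"
    and small: "norm ((1 - p) * (1 - s * t)) < 1"
  obtains r S where "S = r * (1 - p) * s" "p * r = p" "S * t * S = S" "1 - S * t = r * p"
    "(1 - p) * s * (1 - t * S) = 0" "stabilises (1 - s * t) (1 - t * s) (1 - S * t) (1 - t * S)"
proof -
  define q where "q = 1 - p"
  define f where "f = 1 - s * t"
  define g where "g = 1 - t * s"
  obtain r where r: "r * (1 - q * f) = 1" "(1 - q * f) * r = 1"
    using small unfolding q_def f_def by (rule neumann_inverse)
  have f: "f * f = f" and g: "g * g = g"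
    using outer_inverse_idempotent[OF s] by (simp_all add: f_def g_def)
  have q: "q * q = q" "p * q = 0" "q * p = 0" using p by (simp_all add: q_def algebra_simps)
  have sg: "s * g = 0" using s by (simp add: g_def algebra_simps)
  have st: "s * t = 1 - f" and ts: "t * s = 1 - g" by (simp_all add: f_def g_def)
  have pr: "p * r = p"
  proof -
    have "p = p * (1 - q * f)" by (simp add: algebra_simps q flip: mult.assoc)
    then have "p * r = p * ((1 - q * f) * r)" by (simp flip: mult.assoc)
    then show ?thesis by (simp add: r)
  qed
  have qf: "q * (1 - f) = (1 - q * f) - p" by (simp add: q_def algebra_simps)
  have rq: "r * q * (1 - f) = 1 - r * p"
  proof -
    have "r * (q * (1 - f)) = r * (1 - q * f) - r * p" unfolding qf by (simp only: right_diff_distrib)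
    then show ?thesis by (simp add: r mult.assoc)
  qed
  define S where "S = r * q * s"
  have St: "S * t = 1 - r * p"
    using rq by (simp add: S_def mult.assoc st)
  have pS: "p * S = 0" by (simp add: S_def pr q flip: mult.assoc)
  have S: "S * t * S = S" by (simp add: St left_diff_distrib mult.assoc pS)
  have one_St: "1 - S * t = r * p" by (simp add: St)
  define h where "h = 1 - t * S"
  have hh: "h * h = h" using outer_inverse_idempotent[OF S] by (simp add: h_def)
  have qsh: "q * s * h = 0"
  proof -
    have "q * s * (t * S) = q * (1 - f) * S" by (simp add: mult.assoc flip: st)
    also have "\<dots> = (1 - q * f) * S - p * S" unfolding qf by (simp only: left_diff_distrib)
    also have "\<dots> = ((1 - q * f) * r) * (q * s)" by (simp add: pS) (simp add: S_def mult.assoc)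
    finally show ?thesis by (simp add: h_def r right_diff_distrib)
  qed
  have hg: "h * g = g" by (simp add: h_def left_diff_distrib S_def mult.assoc sg)
  \<comment> \<open>\<open>p = j1 + k1\<close>, where \<open>j1\<close> is a copy of \<open>f\<close> and \<open>k1\<close> projects onto the part of the
    range of \<open>p\<close> that \<open>f\<close> annihilates\<close>
  define j1 where "j1 = p * f * r * p"
  define k1 where "k1 = p - j1"
  have frpf: "f * r * p * f = f"
  proof -
    have "(1 - q * f) * (1 - f) = 1 - f" by (simp add: algebra_simps f)
    then have "r * (1 - f) = 1 - f"
      by (metis r(1) mult.assoc mult.left_neutral)
    moreover have "p * f = (1 - q * f) - (1 - f)" by (simp add: q_def algebra_simps)
    then have "r * (p * f) = r * (1 - q * f) - r * (1 - f)" by (simp only: right_diff_distrib)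
    ultimately have "r * (p * f) = f" by (simp only: r) simp
    then show ?thesis by (simp add: mult.assoc f)
  qed
  have fj: "f \<approx>\<^sub>v j1"
  proof (rule mvnI[of "f * r * p" "p * f"])
    show "f * r * p * (p * f) = f" using frpf by (simp add: mult.assoc p) (metis mult.assoc p)
    show "p * f * (f * r * p) = j1" unfolding j1_def by (metis f mult.assoc)
    show "j1 * j1 = j1" unfolding j1_def by (metis frpf p mult.assoc)
  qed (fact f)
  have pj: "p * j1 = j1" "j1 * p = j1" and jj: "j1 * j1 = j1"
    using fj p unfolding mvn_def by (simp_all add: j1_def mult.assoc) (metis mult.assoc p)+
  \<comment> \<open>\<open>h = j2 + k2\<close>, where \<open>j2\<close> is a copy of \<open>g\<close>; the idempotent \<open>l\<close> is \<open>k2\<close> transported to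
    the domain, and it has the same kernel as \<open>k1\<close>\<close>
  define j2 where "j2 = g * h"
  define k2 where "k2 = t * s * h"
  define l where "l = (1 - f) * r * p"
  have gj: "g \<approx>\<^sub>v j2"
  proof (rule mvn_same_range)
    show "g * j2 = j2" by (simp add: j2_def g flip: mult.assoc)
    show "j2 * g = g" by (simp add: j2_def hg g mult.assoc)
  qed
  have jk2: "j2 + k2 = h" by (simp add: j2_def k2_def ts flip: distrib_right)
  have hj: "h * j2 = j2" "j2 * h = j2"
    by (metis j2_def hg hh mult.assoc)+
  have k2: "k2 = h - j2" by (simp flip: jk2)
  have skt: "s * k2 * t = l"
  proof -
    have 1: "h * t = t * (r * p)" 
      by (simp add: h_def left_diff_distrib St mult.assoc right_diff_distrib)
    have "s * k2 * t = (1 - f) * (1 - f) * (r * p)"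
      unfolding k2_def by (simp add: 1 mult.assoc flip: st)
    also have "(1 - f) * (1 - f) = 1 - f" using f by (simp add: algebra_simps)
    finally show ?thesis by (simp add: l_def mult.assoc)
  qed
  have k2i: "k2 * k2 = k2" using gj by (simp add: k2 hh hj algebra_simps mvn_def)
  have gk2: "g * k2 = 0" unfolding k2 j2_def by (simp add: right_diff_distrib g flip: mult.assoc)
  have tsk2: "t * s * k2 = k2" by (simp add: ts left_diff_distrib gk2)
  have ll: "l * l = l"
  proof -
    have "l * l = s * k2 * (t * s * k2) * t" by (simp only: skt[symmetric] mult.assoc)
    also have "\<dots> = s * (k2 * k2) * t" by (simp only: tsk2) (simp only: mult.assoc)
    finally show ?thesis by (simp only: k2i skt)
  qed
  have k2l: "k2 \<approx>\<^sub>v l"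
  proof (rule mvnI[of "k2 * t" "s * k2"])
    show "s * k2 * (k2 * t) = l" unfolding skt[symmetric] by (metis k2i mult.assoc)
    have "k2 * g = 0" unfolding k2 by (simp add: left_diff_distrib hg j2_def mult.assoc g)
    then have "k2 * (t * s) = k2" by (simp add: ts right_diff_distrib)
    then show "k2 * t * (s * k2) = k2" by (metis mult.assoc k2i)
  qed (fact k2i ll)+
  have pl: "p * l = k1"
    by (simp add: l_def k1_def j1_def left_diff_distrib right_diff_distrib p flip: mult.assoc)
      (simp add: pr p)
  have lp: "l * p = l" by (simp add: l_def mult.assoc p)
  have lk1: "l \<approx>\<^sub>v k1"
  proof (rule mvnI[of l p])
    show "k1 * k1 = k1" by (simp add: k1_def algebra_simps pj jj p)
  qed (fact pl lp ll)+
  have "stabilises f g (1 - S * t) h"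
    unfolding stabilises_def
  proof (intro exI conjI)
    show "f \<approx>\<^sub>v j1" "g \<approx>\<^sub>v j2" by fact+
    show "k1 \<approx>\<^sub>v k2" using k2l lk1 by (blast intro: mvn_sym mvn_trans)
    show "j1 * k1 = 0" "k1 * j1 = 0" by (simp_all add: k1_def algebra_simps pj jj)
    show "j2 * k2 = 0" "k2 * j2 = 0" using gj by (simp_all add: k2 algebra_simps hj mvn_def)
    show "j2 + k2 \<approx>\<^sub>v h" unfolding jk2 by (rule mvn_same_range) (simp_all add: hh)
    have "p \<approx>\<^sub>v r * p"
      by (rule mvn_same_kernel) (simp_all add: mult.assoc p, simp add: pr p flip: mult.assoc)
    then show "j1 + k1 \<approx>\<^sub>v 1 - S * t" by (simp add: k1_def one_St)
  qed
  then show ?thesis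
    by (intro that[of S r]) (use pr S one_St qsh in \<open>simp_all add: S_def q_def f_def g_def h_def\<close>)
qed

text \<open>The well-definedness of the index, in the form needed for openness. The outer inverse \<open>s\<close>
  is perturbed to an outer inverse \<open>s1\<close> of \<open>t'\<close>, and one idempotent \<open>p\<close> in \<open>F\<close> enlarges all three of
  \<open>s\<close>, \<open>s1\<close> and \<open>s2\<close>. Domain complements become equivalent to \<open>p\<close>. For \<open>s1\<close> and \<open>s2\<close> the
  codomain complements are both complements of the image under \<open>t'\<close> of the range of \<open>1 - p\<close>, so
  they are equivalent. For \<open>s\<close> and \<open>s1 = s * w\<close> they are the kernels of \<open>(1 - p) * s\<close> and
  \<open>(1 - p) * s * w\<close>, which the invertible \<open>w\<close> identifies. Thus the enlarged decomposition of \<open>t\<close>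
  inherits its complements from the given decomposition of \<open>t'\<close>. Only \<open>s\<close> bounds the distance between
  \<open>t\<close> and \<open>t'\<close>, whatever \<open>s2\<close> is.\<close>

lemma common_enlargement:
  fixes s t s2 t' :: "'a::{real_normed_algebra_1,banach}"
  assumes ideal: "\<And>a x. x \<in> F \<Longrightarrow> a * x \<in> F"
    and unit: "\<And>X. finite X \<Longrightarrow> X \<subseteq> F \<Longrightarrow> \<exists>p\<in>F. p * p = p \<and> (\<forall>x\<in>X. norm ((1 - p) * x) < 1)"
    and s: "s * t * s = s" "1 - s * t \<in> F" and s2: "s2 * t' * s2 = s2" "1 - s2 * t' \<in> F"
    and near: "norm s * norm (t' - t) < 1"
  obtains S where "S * t * S = S" "1 - S * t \<in> F"
    "stabilises (1 - s2 * t') (1 - t' * s2) (1 - S * t) (1 - t * S)"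
proof -
  define W where "W = 1 + (t' - t) * s"
  obtain u w s1 where "w * (1 + (t' - t) * s) = 1"
    "(1 + (t' - t) * s) * w = 1" "s1 = s * w" "s1 * (t + (t' - t)) * s1 = s1"
    "1 - s1 * (t + (t' - t)) = u * (1 - s * t)" "1 - (t + (t' - t)) * s1 = (1 - t * s) * w"
    by (rule outer_inverse_perturb[OF s(1) near])
  then have w: "w * W = 1" "W * w = 1" and s1: "s1 = s * w" "s1 * t' * s1 = s1"
    and s1F: "1 - s1 * t' \<in> F"
    using ideal[OF s(2)] by (simp_all add: W_def)
  obtain p where p: "p \<in> F" "p * p = p" and small: "norm ((1 - p) * (1 - s * t)) < 1"
    "norm ((1 - p) * (1 - s1 * t')) < 1" "norm ((1 - p) * (1 - s2 * t')) < 1"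
    using unit[of "{1 - s * t, 1 - s1 * t', 1 - s2 * t'}"] s(2) s1F s2(2) by auto
  obtain r S where S: "S = r * (1 - p) * s" "p * r = p" "S * t * S = S"
      "1 - S * t = r * p" "(1 - p) * s * (1 - t * S) = 0"
    and st1: "stabilises (1 - s * t) (1 - t * s) (1 - S * t) (1 - t * S)"
    by (rule outer_inverse_enlarge[OF s(1) p(2) small(1)])
  obtain r1 S1 where S1: "S1 = r1 * (1 - p) * s1" "p * r1 = p" "S1 * t' * S1 = S1"
      "1 - S1 * t' = r1 * p" "(1 - p) * s1 * (1 - t' * S1) = 0"
    and st2: "stabilises (1 - s1 * t') (1 - t' * s1) (1 - S1 * t') (1 - t' * S1)"
    by (rule outer_inverse_enlarge[OF s1(2) p(2) small(2)])
  obtain r2 S2 where S2: "S2 = r2 * (1 - p) * s2" "p * r2 = p" "S2 * t' * S2 = S2"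
      "1 - S2 * t' = r2 * p" "(1 - p) * s2 * (1 - t' * S2) = 0"
    and st3: "stabilises (1 - s2 * t') (1 - t' * s2) (1 - S2 * t') (1 - t' * S2)"
    by (rule outer_inverse_enlarge[OF s2(1) p(2) small(3)])
  have pq: "p * (1 - p) = 0" using p(2) by (simp add: right_diff_distrib)
  have pS: "p * S1 = 0" "p * S2 = 0"
    by (simp_all add: S1(1,2) S2(1,2) pq flip: mult.assoc)
  have dom: "1 - S2 * t' \<approx>\<^sub>v 1 - S * t"
    unfolding S(4) S2(4) by (rule mvn_same_kernel) (metis S(2) S2(2) p(2) mult.assoc)+
  have "S1 * t' = 1 - r1 * p" "S2 * t' = 1 - r2 * p"
    by (simp_all flip: S1(4) S2(4))
  then have "S1 * t' * S2 = S2" "S2 * t' * S1 = S1"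
    by (simp_all add: left_diff_distrib mult.assoc pS)
  then have cod1: "1 - t' * S2 \<approx>\<^sub>v 1 - t' * S1"
    by (intro mvn_same_kernel) (simp_all add: left_diff_distrib right_diff_distrib mult.assoc)
  define e where "e = 1 - t * S"
  define e' where "e' = 1 - t' * S1"
  have "e \<approx>\<^sub>v W * e * w"
    using w outer_inverse_idempotent(2)[OF S(3)] unfolding e_def by (intro mvn_conjugate)
  moreover have "W * e * w \<approx>\<^sub>v e'"
  proof (rule mvn_same_range)
    have "S1 * (W * e * w) = r1 * ((1 - p) * s * (w * W) * e) * w"
      by (simp add: S1(1) s1(1) mult.assoc)
    also have "\<dots> = 0" using S(5) by (simp add: w e_def)
    finally show "e' * (W * e * w) = W * e * w"
      unfolding e'_def by (simp add: left_diff_distrib mult.assoc)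
    have "S * (w * e') = r * ((1 - p) * s1 * e')" by (simp add: S(1) s1(1) mult.assoc)
    also have "\<dots> = 0" using S1(5) by (simp add: e'_def)
    finally have "e * (w * e') = w * e'"
      unfolding e_def by (simp add: left_diff_distrib mult.assoc)
    then have "W * e * w * e' = W * w * e'" by (simp add: mult.assoc)
    then show "W * e * w * e' = e'" by (simp add: w)
  qed
  ultimately have "1 - t' * S2 \<approx>\<^sub>v 1 - t * S"
    using cod1 unfolding e_def e'_def by (blast intro: mvn_trans mvn_sym)
  then have "stabilises (1 - s2 * t') (1 - t' * s2) (1 - S * t) (1 - t * S)"
    using stabilises_mvn_cong[OF st3 dom] by blast
  moreover have "1 - S * t \<in> F" using ideal[OF p(1)] by (simp add: S(4))
  ultimately show ?thesis using that S(3) by blast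
qed

section \<open>Complemented submodules as ranges of idempotents\<close>

definition range_module :: "'a::unital_cstar_algebra \<Rightarrow> 'a set" where
  "range_module e = {x. e * x = x}"

lemma closed_submodule_range_module: "closed_submodule (range_module e)"
proof -
  have "closed {x. e * x = x}"
    by (intro closed_Collect_eq continuous_intros)
  then show ?thesis
    by (auto simp: closed_submodule_def range_module_def distrib_left simp flip: mult.assoc)
qed

lemma closed_submodule_diff:
  assumes "closed_submodule M" "x \<in> M" "y \<in> M"
  shows "x - y \<in> M"
proof -
  have "y * (- 1) \<in> M" using assms(1,3) unfolding closed_submodule_def by blast
  then have "x + y * (- 1) \<in> M" using assms(1,2) unfolding closed_submodule_def by blast
  then show ?thesis by simp
qed

lemma direct_decomposition_range_module:
  assumes "e * e = e"
  shows "direct_decomposition (range_module e) (range_module (1 - e))"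
  unfolding direct_decomposition_def
proof (intro conjI closed_submodule_range_module)
  show "range_module e \<inter> range_module (1 - e) = {0}"
    by (auto simp: range_module_def left_diff_distrib)
  have "\<exists>x y. z = x + y \<and> x \<in> range_module e \<and> y \<in> range_module (1 - e)" for z
    using assms
    by (intro exI[of _ "e * z"] exI[of _ "z - e * z"])
      (auto simp: range_module_def algebra_simps simp flip: mult.assoc)
  then show "{x + y |x y. x \<in> range_module e \<and> y \<in> range_module (1 - e)} = UNIV" by auto
qed

text \<open>Splitting the unit as \<open>1 = e + f\<close> along the decomposition is enough: the component of \<open>a\<close> in \<open>M\<close>
  is then \<open>e * a\<close>.\<close>

lemma direct_decomposition_idempotent:
  assumes "direct_decomposition M N"
  obtains e where "e * e = e" "M = range_module e" "N = range_module (1 - e)"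
proof -
  have M: "closed_submodule M" and N: "closed_submodule N" and MN: "M \<inter> N = {0}"
    and sum: "{x + y |x y. x \<in> M \<and> y \<in> N} = UNIV"
    using assms by (auto simp: direct_decomposition_def)
  have "1 \<in> {x + y |x y. x \<in> M \<and> y \<in> N}" by (simp add: sum)
  then obtain e f where ef: "1 = e + f" "e \<in> M" "f \<in> N" by blast
  have mem: "e * a \<in> M" "f * a \<in> N" for a
    using ef M N unfolding closed_submodule_def by blast+
  have split: "a = e * a + f * a" for a by (simp flip: distrib_right ef(1))
  have Me: "e * x = x" if "x \<in> M" for x
  proof -
    have "f * x = x - e * x" using split[of x] by (simp add: algebra_simps)
    then have "f * x \<in> M \<inter> N" using that mem closed_submodule_diff[OF M] by (metis IntI)
    then show ?thesis using split[of x] MN by auto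
  qed
  have Nf: "f * x = x" if "x \<in> N" for x
  proof -
    have "e * x = x - f * x" using split[of x] by (simp add: algebra_simps)
    then have "e * x \<in> M \<inter> N" using that mem closed_submodule_diff[OF N] by (metis IntI)
    then show ?thesis using split[of x] MN by auto
  qed
  have "f = 1 - e" by (simp add: ef(1))
  moreover have "M = range_module e"
    by (auto simp: range_module_def Me) (metis mem(1))
  moreover have "N = range_module f"
    by (auto simp: range_module_def Nf) (metis mem(2))
  ultimately show ?thesis using that Me[OF ef(2)] by blast
qed

lemma module_isoI:
  assumes f: "bounded_module_map M N f" and g: "bounded_module_map N M g"
    and gf: "\<And>x. x \<in> M \<Longrightarrow> g (f x) = x" and fg: "\<And>y. y \<in> N \<Longrightarrow> f (g y) = y"
    and N: "closed_submodule N"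
  shows "module_iso M N f"
proof -
  have bij: "bij_betw f M N"
    by (rule bij_betw_byWitness[of _ g])
      (use assms in \<open>auto simp: bounded_module_map_def\<close>)
  have inv: "inv_into M f y = g y" if "y \<in> N" for y
    using that bij fg g unfolding bounded_module_map_def
    by (metis bij_betw_inv_into_left)
  have "bounded_module_map N M (inv_into M f)"
    using g N unfolding bounded_module_map_def closed_submodule_def by (simp add: inv)
  then show ?thesis using bij f by (simp add: module_iso_def)
qed

lemma bounded_module_map_left_mult:
  assumes "\<And>x. x \<in> M \<Longrightarrow> b * x \<in> N"
  shows "bounded_module_map M N ((*) b)"
  using assms norm_mult_ineq[of b]
  by (auto simp: bounded_module_map_def distrib_left mult.assoc)

lemma module_iso_bounded_below:
  assumes "module_iso M N f"
  obtains c where "c > 0" "\<And>x. x \<in> M \<Longrightarrow> c * norm x \<le> norm (f x)"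
proof -
  obtain K where K: "\<And>y. y \<in> N \<Longrightarrow> norm (inv_into M f y) \<le> K * norm y"
    using assms unfolding module_iso_def bounded_module_map_def by blast
  define C where "C = \<bar>K\<bar> + 1"
  have "1 / C * norm x \<le> norm (f x)" if x: "x \<in> M" for x
  proof -
    have "inv_into M f (f x) = x" "f x \<in> N"
      using assms x unfolding module_iso_def by (auto simp: bij_betw_inv_into_left bij_betwE)
    then have "norm x \<le> K * norm (f x)" using K by metis
    also have "\<dots> \<le> C * norm (f x)" unfolding C_def by (intro mult_right_mono) auto
    finally show ?thesis unfolding C_def by (simp add: field_simps)
  qed
  then show ?thesis by (intro that[of "1 / C"]) (auto simp: C_def)
qed

text \<open>A module map out of the range of \<open>e\<close> is left multiplication by its value at \<open>e\<close>.\<close>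

lemma isomorphic_range_module_iff:
  assumes e: "e * e = e" and f: "f * f = f"
  shows "range_module e \<cong>\<^sub>m range_module f \<longleftrightarrow> e \<approx>\<^sub>v f"
proof
  assume "range_module e \<cong>\<^sub>m range_module f"
  then obtain \<phi> where iso: "module_iso (range_module e) (range_module f) \<phi>"
    by (auto simp: isomorphic_modules_def)
  define \<psi> where "\<psi> = inv_into (range_module e) \<phi>"
  have bij: "bij_betw \<phi> (range_module e) (range_module f)"
    and \<phi>: "bounded_module_map (range_module e) (range_module f) \<phi>"
    and \<psi>: "bounded_module_map (range_module f) (range_module e) \<psi>"
    using iso by (auto simp: module_iso_def \<psi>_def)
  have ef: "e \<in> range_module e" "f \<in> range_module f" using e f by (simp_all add: range_module_def)
  have y: "\<phi> e \<in> range_module f" and x: "\<psi> f \<in> range_module e"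
    using \<phi> \<psi> ef by (auto simp: bounded_module_map_def)
  have "\<psi> f * \<phi> e = \<psi> (f * \<phi> e)" using \<psi> ef by (simp add: bounded_module_map_def)
  also have "\<dots> = e" using y bij ef by (simp add: range_module_def \<psi>_def bij_betw_inv_into_left)
  finally have 1: "\<psi> f * \<phi> e = e" .
  have "\<phi> e * \<psi> f = \<phi> (e * \<psi> f)" using \<phi> ef by (simp add: bounded_module_map_def)
  also have "\<dots> = f" using x bij ef by (simp add: range_module_def \<psi>_def bij_betw_inv_into_right)
  finally show "e \<approx>\<^sub>v f" using mvnI[OF 1] e f by blast
next
  assume "e \<approx>\<^sub>v f"
  then obtain x y where xy: "x * y = e" "y * x = f" "e * x = x" "f * y = y"
    by (rule mvn_normalized)
  have "module_iso (range_module e) (range_module f) ((*) y)"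
    by (rule module_isoI[of _ _ _ "(*) x", OF bounded_module_map_left_mult
          bounded_module_map_left_mult _ _ closed_submodule_range_module])
      (auto simp: range_module_def xy simp flip: mult.assoc)
  then show "range_module e \<cong>\<^sub>m range_module f" by (auto simp: isomorphic_modules_def)
qed

text \<open>The bounded inverse of an isomorphism is the lower bound; conversely a lower bound makes the image
  complete, hence closed.\<close>

lemma sub_isomorphic_range_module_iff:
  assumes e: "e * e = e"
  shows "range_module e \<preceq>\<^sub>m range_module f \<longleftrightarrow> embeds e f"
proof
  assume "range_module e \<preceq>\<^sub>m range_module f"
  then obtain K \<phi> where K: "K \<subseteq> range_module f" and iso: "module_iso (range_module e) K \<phi>"
    by (auto simp: sub_isomorphic_modules_def isomorphic_modules_def)
  have \<phi>: "bounded_module_map (range_module e) K \<phi>" using iso by (simp add: module_iso_def)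
  have e': "e \<in> range_module e" using e by (simp add: range_module_def)
  have "f * \<phi> e = \<phi> e" using \<phi> K e' by (auto simp: bounded_module_map_def range_module_def)
  moreover have \<phi>a: "\<phi> e * a = \<phi> a" if "e * a = a" for a
    using \<phi> e' that unfolding bounded_module_map_def by metis
  moreover obtain c where "c > 0" "\<And>a. a \<in> range_module e \<Longrightarrow> c * norm a \<le> norm (\<phi> a)"
    using module_iso_bounded_below[OF iso] by blast
  ultimately show "embeds e f" unfolding embeds_def
    by (intro exI[of _ "\<phi> e"] exI[of _ c]) (auto simp: range_module_def \<phi>a)
next
  assume "embeds e f"
  then obtain x c where c: "c > 0" and x: "f * x = x"
    and below: "\<And>a. a \<in> range_module e \<Longrightarrow> c * norm a \<le> norm (x * a)"
    by (auto simp: embeds_def range_module_def)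
  define K where "K = (*) x ` range_module e"
  have cs: "closed_submodule (range_module e)" by (rule closed_submodule_range_module)
  have "complete K" unfolding K_def
  proof (rule complete_isometric_image[OF c])
    show "subspace (range_module e)"
      by (auto simp: subspace_def range_module_def distrib_left)
    show "complete (range_module e)"
      using cs by (simp add: closed_submodule_def complete_eq_closed)
  qed (use below in \<open>auto intro: bounded_linear_mult_right\<close>)
  then have K: "closed_submodule K"
    unfolding closed_submodule_def
  proof (intro conjI ballI allI)
    show "closed K" using \<open>complete K\<close> by (rule complete_imp_closed)
    show "0 \<in> K" using cs unfolding K_def closed_submodule_def by force
    show "k + l \<in> K" if "k \<in> K" "l \<in> K" for k l
      using cs that unfolding K_def closed_submodule_def by (auto simp flip: distrib_left)
    show "k * a \<in> K" if "k \<in> K" for k a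
      using cs that unfolding K_def closed_submodule_def by (auto simp: mult.assoc)
  qed
  have inj: "inj_on ((*) x) (range_module e)"
  proof (rule inj_onI)
    fix a b assume ab: "a \<in> range_module e" "b \<in> range_module e" "x * a = x * b"
    then have "c * norm (a - b) \<le> norm (x * (a - b))"
      using below closed_submodule_diff[OF cs] by blast
    then show "a = b" using ab(3) c by (simp add: right_diff_distrib mult_le_0_iff)
  qed
  have "module_iso (range_module e) K ((*) x)"
  proof (rule module_isoI[of _ _ _ "inv_into (range_module e) ((*) x)"])
    show "bounded_module_map (range_module e) K ((*) x)"
      by (rule bounded_module_map_left_mult) (simp add: K_def)
    have inv: "inv_into (range_module e) ((*) x) (x * a) = a" if "a \<in> range_module e" for a
      using inj that by (rule inv_into_f_f)
    have "norm a \<le> 1 / c * norm (x * a)" if "a \<in> range_module e" for a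
      using below[OF that] c by (simp add: field_simps)
    then show "bounded_module_map K (range_module e) (inv_into (range_module e) ((*) x))"
      using cs unfolding bounded_module_map_def closed_submodule_def K_def
      by (auto simp: inv mult.assoc simp flip: distrib_left intro!: exI[of _ "1 / c"])
    show "\<And>a. a \<in> range_module e \<Longrightarrow> inv_into (range_module e) ((*) x) (x * a) = a"
      by (rule inv)
    show "\<And>y. y \<in> K \<Longrightarrow> x * inv_into (range_module e) ((*) x) y = y"
      by (auto simp: K_def inv)
  qed (fact K)
  moreover have "K \<subseteq> range_module f" using x by (auto simp: K_def range_module_def simp flip: mult.assoc)
  ultimately show "range_module e \<preceq>\<^sub>m range_module f"
    using K by (auto simp: sub_isomorphic_modules_def isomorphic_modules_def)
qed

text \<open>The projection \<open>p\<close> and the idempotent \<open>f\<close> have the same range, so \<open>f = p * f\<close> and \<open>p = f * p\<close>,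
  and an ideal contains both or neither.\<close>

lemma orth_projection_in_range_module_iff:
  assumes ideal: "\<forall>x\<in>F. \<forall>a. a * x \<in> F \<and> x * a \<in> F" and f: "f * f = f"
  shows "orth_projection_in F (range_module f) \<longleftrightarrow> f \<in> F"
proof
  assume "orth_projection_in F (range_module f)"
  then obtain p where p: "p \<in> F"
    and P: "is_orth_projection_onto (left_mult p) (range_module f)"
    by (auto simp: orth_projection_in_def)
  have mem: "p * a \<in> range_module f" and orth: "y \<in> range_module f \<Longrightarrow> star y * (a - p * a) = 0" for a y
    using P by (auto simp: is_orth_projection_onto_def mod_inner_def left_mult.rep_eq)
  have "f \<in> range_module f" using f by (simp add: range_module_def)
  then have "f - p * f \<in> range_module f"
    using mem closed_submodule_diff[OF closed_submodule_range_module] by blast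
  then have "f - p * f = 0" using orth by (blast intro: star_mult_self_eq_0)
  then have "f = p * f" by simp
  then show "f \<in> F" using ideal p by metis
next
  assume fF: "f \<in> F"
  obtain p where p: "is_projection p" "p * f = f" "f * p = p"
    using range_projection_exists[OF f] by blast
  have "p \<in> F" using ideal fF p(3) by metis
  moreover have "is_orth_projection_onto (left_mult p) (range_module f)"
    unfolding is_orth_projection_onto_def
  proof (intro conjI allI ballI)
    show "left_mult p \<in> module_operators"
      by (simp add: module_operators_def left_mult.rep_eq mult.assoc)
    fix a
    show "left_mult p a \<in> range_module f"
      by (simp add: left_mult.rep_eq range_module_def p flip: mult.assoc)
    fix y assume "y \<in> range_module f"
    then have "p * y = y" using p(2) by (metis (mono_tags) mem_Collect_eq mult.assoc range_module_def)
    then have "star y * p = star y" using p(1) by (metis is_projection_def star_mult)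
    then show "mod_inner y (a - left_mult p a) = 0"
      by (simp add: mod_inner_def left_mult.rep_eq right_diff_distrib flip: mult.assoc)
  qed
  ultimately show "orth_projection_in F (range_module f)" by (auto simp: orth_projection_in_def)
qed

section \<open>Decompositions as outer inverses\<close>

lemma module_operator_eq_left_mult:
  assumes "T \<in> module_operators"
  shows "blinfun_apply T x = T 1 * x"
proof -
  have "T (1 * x) = T 1 * x" using assms unfolding module_operators_def by blast
  then show ?thesis by simp
qed

lemma outer_inverse_decomposition:
  assumes T: "T \<in> module_operators" and s: "s * T 1 * s = s"
  shows "iso_decomposition T (range_module (s * T 1)) (range_module (1 - s * T 1))
    (range_module (T 1 * s)) (range_module (1 - T 1 * s))"
proof -
  define t where "t = T 1"
  have app: "blinfun_apply T = (*) t"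
    unfolding t_def by (rule ext) (rule module_operator_eq_left_mult[OF T])
  have s': "s * t * s = s" using s by (simp add: t_def)
  then have i: "s * t * (s * t) = s * t" "t * s * (t * s) = t * s"
    by (metis mult.assoc)+
  have "module_iso (range_module (s * t)) (range_module (t * s)) ((*) t)"
    by (rule module_isoI[of _ _ _ "(*) s", OF bounded_module_map_left_mult
          bounded_module_map_left_mult _ _ closed_submodule_range_module])
      (use s' in \<open>auto simp: range_module_def mult.assoc\<close>)
  moreover have "t * x \<in> range_module (1 - t * s)" if "x \<in> range_module (1 - s * t)" for x
    using that by (simp add: range_module_def left_diff_distrib mult.assoc)
  ultimately have "iso_decomposition T (range_module (s * t)) (range_module (1 - s * t))
    (range_module (t * s)) (range_module (1 - t * s))"
    unfolding iso_decomposition_def app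
    using direct_decomposition_range_module i by (auto simp: module_iso_def bounded_module_map_def)
  then show ?thesis by (simp only: t_def)
qed

text \<open>The inverse of \<open>T\<close> on \<open>M2\<close>, composed with the projection onto \<open>M2\<close> along \<open>N2\<close>, is a module map
  and therefore left multiplication by an element \<open>s\<close>, the value at the component of \<open>1\<close> in \<open>M2\<close>.\<close>

lemma decomposition_outer_inverse:
  assumes T: "T \<in> module_operators" and dec: "iso_decomposition T M1 N1 M2 N2"
  obtains s where "s * T 1 * s = s" "N1 = range_module (1 - s * T 1)" "N2 = range_module (1 - T 1 * s)"
proof -
  define t where "t = T 1"
  have app: "blinfun_apply T = (*) t"
    unfolding t_def by (rule ext) (rule module_operator_eq_left_mult[OF T])
  have "direct_decomposition M1 N1" "direct_decomposition M2 N2"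
    and sub: "(*) t ` M1 \<subseteq> M2" "(*) t ` N1 \<subseteq> N2" and iso: "module_iso M1 M2 ((*) t)"
    using dec unfolding iso_decomposition_def app by auto
  then obtain e1 e2 where e1: "e1 * e1 = e1" "M1 = range_module e1" "N1 = range_module (1 - e1)"
    and e2: "e2 * e2 = e2" "M2 = range_module e2" "N2 = range_module (1 - e2)"
    by (metis direct_decomposition_idempotent)
  define \<psi> where "\<psi> = inv_into M1 ((*) t)"
  have bij: "bij_betw ((*) t) M1 M2" and \<psi>: "bounded_module_map M2 M1 \<psi>"
    using iso by (auto simp: module_iso_def \<psi>_def)
  have mem: "e1 \<in> M1" "e2 \<in> M2" "1 - e1 \<in> N1"
    using e1 e2 by (auto simp: range_module_def algebra_simps)
  define s where "s = \<psi> e2"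
  have sy: "s * a = \<psi> (e2 * a)" for a
    using \<psi> mem(2) by (simp add: s_def bounded_module_map_def)
  have ts: "t * s = e2"
    using bij mem(2) by (simp add: s_def \<psi>_def bij_betw_inv_into_right)
  have "e1 * s = s"
    using \<psi> mem(2) by (auto simp: s_def bounded_module_map_def e1(2) range_module_def)
  have "t * e1 \<in> M2" using sub mem by blast
  then have "s * (t * e1) = \<psi> (t * e1)" by (simp add: sy e2(2) range_module_def)
  also have "\<dots> = e1" using bij mem(1) by (simp add: \<psi>_def bij_betw_inv_into_left)
  finally have 1: "s * (t * e1) = e1" .
  have "t * (1 - e1) \<in> N2" using sub mem by blast
  then have 2: "e2 * (t * (1 - e1)) = 0" by (simp add: e2(3) range_module_def left_diff_distrib)
  have "s * 0 = \<psi> (e2 * 0)" by (rule sy)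
  then have "s * (t * (1 - e1)) = 0" using 2 by (simp add: sy)
  then have "s * t = e1" using 1 by (simp add: right_diff_distrib)
  then show ?thesis
    using that[of s] ts \<open>e1 * s = s\<close> e1(3) e2(3) by (simp add: t_def)
qed

lemma ex_iso_decomposition_iff:
  assumes "T \<in> module_operators"
  shows "(\<exists>M1 N1 M2 N2. iso_decomposition T M1 N1 M2 N2 \<and> Q N1 N2) \<longleftrightarrow>
    (\<exists>s. s * T 1 * s = s \<and> Q (range_module (1 - s * T 1)) (range_module (1 - T 1 * s)))"
proof safe
  fix M1 N1 M2 N2 assume "iso_decomposition T M1 N1 M2 N2" "Q N1 N2"
  then show "\<exists>s. s * T 1 * s = s \<and> Q (range_module (1 - s * T 1)) (range_module (1 - T 1 * s))"
    by (metis assms decomposition_outer_inverse)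
next
  fix s assume "s * T 1 * s = s" "Q (range_module (1 - s * T 1)) (range_module (1 - T 1 * s))"
  then show "\<exists>M1 N1 M2 N2. iso_decomposition T M1 N1 M2 N2 \<and> Q N1 N2"
    using outer_inverse_decomposition[OF assms] by blast
qed

lemma MKPhi_characterizations:
  assumes ideal: "\<forall>x\<in>F. \<forall>a. a * x \<in> F \<and> x * a \<in> F"
  shows
    "MKPhi_plus F = {T \<in> module_operators. \<exists>s. s * T 1 * s = s \<and> 1 - s * T 1 \<in> F}"
    "MKPhi_minus F = {T \<in> module_operators. \<exists>s. s * T 1 * s = s \<and> 1 - T 1 * s \<in> F}"
    "MKPhi F = {T \<in> module_operators. \<exists>s. s * T 1 * s = s \<and> 1 - s * T 1 \<in> F \<and> 1 - T 1 * s \<in> F}"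
    "MKPhi_plus_minus' F = {T \<in> module_operators. \<exists>s. s * T 1 * s = s \<and> 1 - s * T 1 \<in> F \<and>
       embeds (1 - s * T 1) (1 - T 1 * s)}"
    "MKPhi_minus_plus' F = {T \<in> module_operators. \<exists>s. s * T 1 * s = s \<and> 1 - T 1 * s \<in> F \<and>
       embeds (1 - T 1 * s) (1 - s * T 1)}"
    "MKPhi_0 F = {T \<in> module_operators. \<exists>s. s * T 1 * s = s \<and> 1 - s * T 1 \<in> F \<and> 1 - T 1 * s \<in> F \<and>
       1 - s * T 1 \<approx>\<^sub>v 1 - T 1 * s}"
  unfolding MKPhi_plus_def MKPhi_minus_def MKPhi_def MKPhi_plus_minus'_def MKPhi_minus_plus'_def
    MKPhi_0_def
  by (intro Collect_cong conj_cong refl, subst ex_iso_decomposition_iff, assumption,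
      intro ex_cong1 conj_cong refl;
      simp add: orth_projection_in_range_module_iff[OF ideal] outer_inverse_idempotent
        isomorphic_range_module_iff sub_isomorphic_range_module_iff)+

section \<open>Openness\<close>

lemma finite_type_ideal_facts:
  assumes "finite_type_ideal F"
  shows "\<forall>x\<in>F. \<forall>a. a * x \<in> F \<and> x * a \<in> F" "\<And>x. x \<in> F \<Longrightarrow> star x \<in> F"
    and "\<And>X. finite X \<Longrightarrow> X \<subseteq> F \<Longrightarrow> \<exists>p\<in>F. p * p = p \<and> (\<forall>x\<in>X. norm ((1 - p) * x) < 1)"
proof -
  show "\<forall>x\<in>F. \<forall>a. a * x \<in> F \<and> x * a \<in> F" "\<And>x. x \<in> F \<Longrightarrow> star x \<in> F"
    using assms by (auto simp: finite_type_ideal_def)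
  obtain U where "projection_approximate_unit F U"
    using assms by (auto simp: finite_type_ideal_def)
  then have U: "U \<noteq> bot" "\<forall>\<^sub>F p in U. p \<in> F \<and> is_projection p"
    "\<And>x. x \<in> F \<Longrightarrow> ((\<lambda>p. p * x) \<longlongrightarrow> x) U"
    by (auto simp: projection_approximate_unit_def)
  fix X assume X: "finite X" "X \<subseteq> F"
  have "\<forall>\<^sub>F p in U. norm ((1 - p) * x) < 1" if "x \<in> X" for x
  proof -
    have "\<forall>\<^sub>F p in U. dist (p * x) x < 1"
      using U(3)[of x] that X(2) by (intro tendstoD) auto
    then show ?thesis
      by eventually_elim (simp add: dist_norm norm_minus_commute left_diff_distrib)
  qed
  then have "\<forall>\<^sub>F p in U. \<forall>x\<in>X. norm ((1 - p) * x) < 1"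
    using X(1) by (simp add: eventually_ball_finite_distrib)
  with U(2) have "\<forall>\<^sub>F p in U. (p \<in> F \<and> is_projection p) \<and> (\<forall>x\<in>X. norm ((1 - p) * x) < 1)"
    by (rule eventually_conj)
  then show "\<exists>p\<in>F. p * p = p \<and> (\<forall>x\<in>X. norm ((1 - p) * x) < 1)"
    using eventually_happens'[OF U(1)] by (auto simp: is_projection_def)
qed

lemma mvn_in_ideal:
  assumes "\<forall>x\<in>F. \<forall>a. a * x \<in> F \<and> x * a \<in> F" "e \<in> F" "e \<approx>\<^sub>v f"
  shows "f \<in> F"
proof -
  obtain x y where "y * x = f" "y * e = y"
    using assms(3) by (rule mvn_normalized)
  then show ?thesis using assms(1,2) by metis
qed

text \<open>\<open>A\<close> and \<open>B\<close> are conditions on an operator \<open>t\<close> with a chosen outer inverse. Besides the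
  stability of \<open>A\<close>, openness of the difference requires that no operator near \<open>t\<close> lies in the second
  class when \<open>t\<close> does not, so condition \<open>B\<close> has to be carried back from \<open>t'\<close> to \<open>t\<close>. In both
  directions the radius may depend on \<open>s\<close> alone.\<close>

lemma openin_difference_of_classes:
  fixes A B :: "'a::unital_cstar_algebra \<Rightarrow> 'a \<Rightarrow> bool"
  assumes stable: "\<And>s t t'. s * t * s = s \<Longrightarrow> A s t \<Longrightarrow> norm s * norm (t' - t) < 1 \<Longrightarrow>
      \<exists>s'. s' * t' * s' = s' \<and> A s' t'"
    and reflect: "\<And>s t t' s'. s * t * s = s \<Longrightarrow> A s t \<Longrightarrow> norm s * norm (t' - t) < 1 \<Longrightarrow>
      s' * t' * s' = s' \<Longrightarrow> B s' t' \<Longrightarrow> \<exists>S. S * t * S = S \<and> B S t"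
  shows "openin (top_of_set module_operators)
    ({T \<in> module_operators. \<exists>s. s * T 1 * s = s \<and> A s (T 1)} -
     {T \<in> module_operators. \<exists>s. s * T 1 * s = s \<and> B s (T 1)})" (is "openin _ ?D")
  unfolding openin_euclidean_subtopology_iff
proof (intro conjI ballI)
  show "?D \<subseteq> module_operators" by blast
  fix T assume T: "T \<in> ?D"
  then obtain s where s: "s * T 1 * s = s" "A s (T 1)" by blast
  have pos: "norm s + 1 > 0" by (simp add: add_nonneg_pos)
  have near: "norm s * norm (T' 1 - T 1) < 1" if "dist T' T < 1 / (norm s + 1)" for T'
  proof -
    have "norm (T' 1 - T 1) \<le> dist T' T"
      using norm_blinfun[of "T' - T" 1] by (simp add: dist_norm blinfun.diff_left)
    then have "norm s * norm (T' 1 - T 1) \<le> (norm s + 1) * dist T' T"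
      by (intro mult_mono) auto
    also have "\<dots> < 1" using that pos by (simp add: field_simps)
    finally show ?thesis .
  qed
  have "T' \<in> ?D" if "T' \<in> module_operators" "dist T' T < 1 / (norm s + 1)" for T'
    using that(1) stable[OF s near[OF that(2)]] reflect[OF s near[OF that(2)]] T by blast
  then show "\<exists>e>0. \<forall>T'\<in>module_operators. dist T' T < e \<longrightarrow> T' \<in> ?D"
    using pos by (intro exI[of _ "1 / (norm s + 1)"]) auto
qed

text \<open>Taking adjoints turns \<open>s\<close> into an outer inverse of \<open>star t\<close> and exchanges the two complements.
  This works because the conclusion speaks of equivalences only: adjoints preserve those, whereas they
  turn an embedding of modules into a quotient map.\<close>

lemma common_enlargement_codomain:
  fixes s t s2 t' :: "'a::unital_cstar_algebra"
  assumes F: "finite_type_ideal F"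
    and s: "s * t * s = s" "1 - t * s \<in> F" and s2: "s2 * t' * s2 = s2" "1 - t' * s2 \<in> F"
    and near: "norm s * norm (t' - t) < 1"
  obtains S where "S * t * S = S" "1 - t * S \<in> F"
    "stabilises (1 - t' * s2) (1 - s2 * t') (1 - t * S) (1 - S * t)"
proof -
  note ff = finite_type_ideal_facts[OF F]
  have swap: "1 - star a * star b = star (1 - b * a)" for a b :: 'a
    by (simp add: star_diff star_mult)
  obtain S where S: "S * star t * S = S" "1 - S * star t \<in> F"
    "stabilises (1 - star s2 * star t') (1 - star t' * star s2) (1 - S * star t) (1 - star t * S)"
  proof (rule common_enlargement[of F "star s" "star t" "star s2" "star t'"])
    show "star s * star t * star s = star s" "star s2 * star t' * star s2 = star s2"
      using s(1) s2(1) by (simp_all flip: star_mult add: mult.assoc)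
    show "1 - star s * star t \<in> F" "1 - star s2 * star t' \<in> F"
      using ff(2) s(2) s2(2) by (simp_all add: swap)
    show "norm (star s) * norm (star t' - star t) < 1"
      using near by (simp add: norm_star flip: star_diff)
  qed (use ff in blast)+
  show ?thesis
  proof (rule that[of "star S"])
    show "star S * t * star S = star S"
      using arg_cong[OF S(1), of star] by (simp add: star_mult star_star mult.assoc)
    show "1 - t * star S \<in> F"
      using ff(2)[OF S(2)] by (simp add: star_diff star_mult star_star)
    show "stabilises (1 - t' * s2) (1 - s2 * t') (1 - t * star S) (1 - star S * t)"
      using stabilises_star[OF S(3)] by (simp add: star_diff star_mult star_star)
  qed
qed

theorem proposition3p10:
  fixes F :: "'a::unital_cstar_algebra set"
  assumes "finite_type_ideal F"
  shows "openin (top_of_set module_operators) (MKPhi_plus F - MKPhi_plus_minus' F) \<and>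
         openin (top_of_set module_operators) (MKPhi_minus F - MKPhi_minus_plus' F) \<and>
         openin (top_of_set module_operators) (MKPhi F - MKPhi_0 F)"
proof -
  note ff = finite_type_ideal_facts[OF assms]
  have perturb: "\<exists>s' a b. s' * t' * s' = s' \<and> 1 - s' * t' = a * (1 - s * t) \<and> 1 - t' * s' = (1 - t * s) * b"
    if "s * t * s = s" "norm s * norm (t' - t) < 1" for s t t' :: 'a
    using outer_inverse_perturb[OF that] by (metis add.commute diff_add_cancel)
  have enlarge: "\<exists>S. S * t * S = S \<and> 1 - S * t \<in> F \<and>
      stabilises (1 - s' * t') (1 - t' * s') (1 - S * t) (1 - t * S)"
    if "s * t * s = s" "1 - s * t \<in> F" "norm s * norm (t' - t) < 1"
      "s' * t' * s' = s'" "1 - s' * t' \<in> F" for s t s' t' :: 'a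
    using common_enlargement[of F s t s' t'] that ff(1,3) by metis
  have enlarge': "\<exists>S. S * t * S = S \<and> 1 - t * S \<in> F \<and>
      stabilises (1 - t' * s') (1 - s' * t') (1 - t * S) (1 - S * t)"
    if "s * t * s = s" "1 - t * s \<in> F" "norm s * norm (t' - t) < 1"
      "s' * t' * s' = s'" "1 - t' * s' \<in> F" for s t s' t' :: 'a
    using common_enlargement_codomain[OF assms, of s t s' t'] that by metis
  show ?thesis
    unfolding MKPhi_characterizations[OF ff(1)]
  proof (intro conjI)
    show "openin (top_of_set module_operators)
        ({T \<in> module_operators. \<exists>s. s * T 1 * s = s \<and> 1 - s * T 1 \<in> F} -
         {T \<in> module_operators. \<exists>s. s * T 1 * s = s \<and> 1 - s * T 1 \<in> F \<and>
            embeds (1 - s * T 1) (1 - T 1 * s)})"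
    proof (rule openin_difference_of_classes[of "\<lambda>s t. 1 - s * t \<in> F"
          "\<lambda>s t. 1 - s * t \<in> F \<and> embeds (1 - s * t) (1 - t * s)"])
      fix s t t' :: 'a
      assume h: "s * t * s = s" "1 - s * t \<in> F" "norm s * norm (t' - t) < 1"
      show "\<exists>s'. s' * t' * s' = s' \<and> 1 - s' * t' \<in> F"
        using perturb[OF h(1,3)] h(2) ff(1) by metis
      fix s' assume s': "s' * t' * s' = s'" "1 - s' * t' \<in> F \<and> embeds (1 - s' * t') (1 - t' * s')"
      then show "\<exists>S. S * t * S = S \<and> 1 - S * t \<in> F \<and> embeds (1 - S * t) (1 - t * S)"
        using enlarge[OF h s'(1)] stabilises_embeds by blast
    qed
    show "openin (top_of_set module_operators)
        ({T \<in> module_operators. \<exists>s. s * T 1 * s = s \<and> 1 - T 1 * s \<in> F} -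
         {T \<in> module_operators. \<exists>s. s * T 1 * s = s \<and> 1 - T 1 * s \<in> F \<and>
            embeds (1 - T 1 * s) (1 - s * T 1)})"
    proof (rule openin_difference_of_classes[of "\<lambda>s t. 1 - t * s \<in> F"
          "\<lambda>s t. 1 - t * s \<in> F \<and> embeds (1 - t * s) (1 - s * t)"])
      fix s t t' :: 'a
      assume h: "s * t * s = s" "1 - t * s \<in> F" "norm s * norm (t' - t) < 1"
      show "\<exists>s'. s' * t' * s' = s' \<and> 1 - t' * s' \<in> F"
        using perturb[OF h(1,3)] h(2) ff(1) by metis
      fix s' assume s': "s' * t' * s' = s'" "1 - t' * s' \<in> F \<and> embeds (1 - t' * s') (1 - s' * t')"
      then show "\<exists>S. S * t * S = S \<and> 1 - t * S \<in> F \<and> embeds (1 - t * S) (1 - S * t)"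
        using enlarge'[OF h s'(1)] stabilises_embeds by blast
    qed
    show "openin (top_of_set module_operators)
        ({T \<in> module_operators. \<exists>s. s * T 1 * s = s \<and> 1 - s * T 1 \<in> F \<and> 1 - T 1 * s \<in> F} -
         {T \<in> module_operators. \<exists>s. s * T 1 * s = s \<and> 1 - s * T 1 \<in> F \<and> 1 - T 1 * s \<in> F \<and>
            1 - s * T 1 \<approx>\<^sub>v 1 - T 1 * s})"
    proof (rule openin_difference_of_classes[of "\<lambda>s t. 1 - s * t \<in> F \<and> 1 - t * s \<in> F"
          "\<lambda>s t. 1 - s * t \<in> F \<and> 1 - t * s \<in> F \<and> 1 - s * t \<approx>\<^sub>v 1 - t * s"])
      fix s t t' :: 'a
      assume h: "s * t * s = s" "1 - s * t \<in> F \<and> 1 - t * s \<in> F" "norm s * norm (t' - t) < 1"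
      show "\<exists>s'. s' * t' * s' = s' \<and> 1 - s' * t' \<in> F \<and> 1 - t' * s' \<in> F"
        using perturb[OF h(1,3)] h(2) ff(1) by metis
      fix s' assume s': "s' * t' * s' = s'"
        "1 - s' * t' \<in> F \<and> 1 - t' * s' \<in> F \<and> 1 - s' * t' \<approx>\<^sub>v 1 - t' * s'"
      then obtain S where S: "S * t * S = S" "1 - S * t \<in> F"
        "stabilises (1 - s' * t') (1 - t' * s') (1 - S * t) (1 - t * S)"
        using enlarge[OF h(1) _ h(3) s'(1)] h(2) by blast
      then have "1 - S * t \<approx>\<^sub>v 1 - t * S" using s'(2) stabilises_mvn by blast
      then show "\<exists>S. S * t * S = S \<and> 1 - S * t \<in> F \<and> 1 - t * S \<in> F \<and> 1 - S * t \<approx>\<^sub>v 1 - t * S"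
        using S(1,2) mvn_in_ideal[OF ff(1)] by blast
    qed
  qed
qed

end
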